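(* Let $r,s$ be coprime positive integers with $1\le s<r/2$ and let $k\ge 1$ be an integer. (1) If $2\mid s$ and $k>\dfrac{4r^3s-2s(r-2s)}{r(r-2s)}$, then for all $n\ge 0$ the coefficient of $q^n$ in $$\frac{\sum_{j=0}^{\infty}(-1)^{j}q^{r(j^{2}+(2k+1)j)/2-sj}\left(1-q^{2js+(2k+1)s}\right)}{(1-q^{s})(1-q^{r-s})(1-q^{r+s})}$$ is nonnegative. (2) If $2\nmid s$ and $k>\dfrac{8r^3s-2s(r-2s)}{r(r-2s)}$, then for all $n\ge 0$ the coefficient of $q^n$ in $$\frac{\sum_{j=0}^{\infty}(-1)^{j}q^{r(j^{2}+(2k+1)j)/2-sj}\left(1-q^{2js+(2k+1)s}\right)}{(1-q^{s})(1-q^{r-s})(1-q^{2r-s})}$$ is nonnegative. Moreover, in each of the cases (1) and (2), all coefficients of $$(-1)^{k}\,\frac{\sum_{j=k}^{\infty}(-1)^j q^{r j(j+1)/2}\left(q^{-sj}-q^{(j+1)s}\right)}{\left(q^s,q^{r-s};q^r\right)_{\infty}}$$ are nonnegative.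
   Context: Notation: $(a;q)_\infty=\prod_{n\ge 0}(1-aq^n)$ and $(a_1,\dots,a_m;q)_\infty=(a_1;q)_\infty\cdots(a_m;q)_\infty$. So $(q^s,q^{r-s};q^r)_\infty=\prod_{n\ge 0}(1-q^{s+rn})(1-q^{r-s+rn})$. *)

theory Defs
  imports "HOL-Analysis.Analysis" "HOL-Computational_Algebra.Formal_Power_Series"
begin

text \<open>
  The variable \<open>q\<close> is the indeterminate \<open>fps_X\<close>. Infinite sums and products are those of the
  library (\<open>suminf\<close>, \<open>prodinf\<close>) for the \<open>X\<close>-adic metric on formal power series; convergence
  is proved below.
\<close>

definition qpoch_inf :: "real fps \<Rightarrow> real fps \<Rightarrow> real fps" where
  "qpoch_inf a q = (\<Prod>n. 1 - a * q ^ n)"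

definition qpochs_inf :: "real fps list \<Rightarrow> real fps \<Rightarrow> real fps" where
  "qpochs_inf as q = (\<Prod>a\<leftarrow>as. qpoch_inf a q)"

text \<open>
  The exponents below are natural numbers. For \<open>2 * s \<le> r\<close> the division by 2 is exact and
  the subtraction does not truncate, see \<open>theta_exponent\<close> and \<open>tail_exponent\<close>.
\<close>

definition theta_term :: "nat \<Rightarrow> nat \<Rightarrow> nat \<Rightarrow> nat \<Rightarrow> real fps" where
  "theta_term r s k j =
     (-1) ^ j * fps_X ^ (r * (j\<^sup>2 + (2 * k + 1) * j) div 2 - s * j)
       * (1 - fps_X ^ (2 * j * s + (2 * k + 1) * s))"

definition theta_sum :: "nat \<Rightarrow> nat \<Rightarrow> nat \<Rightarrow> real fps" where
  "theta_sum r s k = (\<Sum>j. theta_term r s k j)"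

text \<open>
  \<open>q\<^bsup>r j (j + 1) / 2\<^esup> (q\<^bsup>- s j\<^esup> - q\<^bsup>(j + 1) s\<^esup>)\<close>, multiplied out so that no negative
  exponent occurs.
\<close>

definition tail_term :: "nat \<Rightarrow> nat \<Rightarrow> nat \<Rightarrow> real fps" where
  "tail_term r s j =
     (-1) ^ j * (fps_X ^ (r * j * (j + 1) div 2 - s * j)
                 - fps_X ^ (r * j * (j + 1) div 2 + (j + 1) * s))"

definition tail_sum :: "nat \<Rightarrow> nat \<Rightarrow> nat \<Rightarrow> real fps" where
  "tail_sum r s k = (\<Sum>j. tail_term r s (k + j))"

lemma exponent_ge:
  fixes r s j k :: nat
  assumes "2 * s \<le> r"
  shows "s * j + s * j\<^sup>2 \<le> r * (j\<^sup>2 + (2 * k + 1) * j) div 2"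
proof -
  have "2 * (s * j + s * j\<^sup>2) = (2 * s) * (j\<^sup>2 + j)"
    by (simp add: algebra_simps)
  also have "\<dots> \<le> r * (j\<^sup>2 + (2 * k + 1) * j)"
    by (intro mult_mono assms) (auto simp: algebra_simps)
  finally have "2 * (s * j + s * j\<^sup>2) \<le> r * (j\<^sup>2 + (2 * k + 1) * j)" .
  from div_le_mono[OF this, of 2] show ?thesis by simp
qed

lemma theta_exponent:
  fixes r s j k :: nat
  assumes "2 * s \<le> r"
  shows "real (r * (j\<^sup>2 + (2 * k + 1) * j) div 2 - s * j)
           = real r * ((real j)\<^sup>2 + (2 * real k + 1) * real j) / 2 - real s * real j"
proof -
  have "even (r * (j\<^sup>2 + (2 * k + 1) * j))"
    by simp
  then have "real (r * (j\<^sup>2 + (2 * k + 1) * j) div 2)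
      = real (r * (j\<^sup>2 + (2 * k + 1) * j)) / 2"
    by (metis real_of_nat_div of_nat_numeral)
  then show ?thesis
    using exponent_ge[OF assms, of j k] by (simp add: algebra_simps)
qed

lemma tail_exponent:
  fixes r s j :: nat
  assumes "2 * s \<le> r"
  shows "real (r * j * (j + 1) div 2 - s * j)
           = real r * real j * (real j + 1) / 2 - real s * real j"
  using theta_exponent[OF assms, of j 0]
  by (simp add: power2_eq_square distrib_left mult.assoc add.commute)

lemma fps_summableI:
  fixes f :: "nat \<Rightarrow> real fps"
  assumes "\<And>j n. n < j \<Longrightarrow> fps_nth (f j) n = 0"
  shows "summable f"
proof -
  define g where "g = Abs_fps (\<lambda>n. \<Sum>j\<le>n. fps_nth (f j) n)"
  have "(\<lambda>m. \<Sum>j<m. f j) \<longlonglongrightarrow> g"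
  proof (rule tendsto_fpsI)
    fix n
    have "fps_nth (\<Sum>j<m. f j) n = fps_nth g n" if "n < m" for m
      unfolding g_def fps_sum_nth fps_nth_Abs_fps
      by (rule sum.mono_neutral_right) (use that assms in \<open>auto simp: not_le\<close>)
    then show "\<forall>\<^sub>F m in sequentially. fps_nth (\<Sum>j<m. f j) n = fps_nth g n"
      using eventually_gt_at_top[of n] by (rule eventually_mono[rotated]) auto
  qed
  then show ?thesis
    by (auto simp: summable_def sums_def)
qed

lemma theta_term_nth_eq_0:
  assumes "1 \<le> s" "2 * s \<le> r" "n < j"
  shows "fps_nth (theta_term r s k j) n = 0"
proof -
  define e where "e = r * (j\<^sup>2 + (2 * k + 1) * j) div 2 - s * j"
  have "j \<le> s * j\<^sup>2"
    using mult_le_mono[OF assms(1) power2_nat_le_imp_le[of j "j\<^sup>2"]] mult_le_mono[OF assms(1), of j "j\<^sup>2"]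
    by (cases j) (auto simp: power2_eq_square)
  then have "n < e"
    using exponent_ge[OF assms(2), of j k] assms(3) by (simp add: e_def)
  then have "fps_nth (fps_X ^ e * ((-1) ^ j * (1 - fps_X ^ (2 * j * s + (2 * k + 1) * s)))) n
      = (0 :: real)"
    by (simp add: fps_X_power_mult_nth)
  then show "fps_nth (theta_term r s k j) n = 0"
    by (simp add: theta_term_def e_def mult_ac)
qed

lemma summable_theta_term:
  assumes "1 \<le> s" "2 * s \<le> r"
  shows "summable (theta_term r s k)"
  by (rule fps_summableI) (rule theta_term_nth_eq_0[OF assms])

lemma tail_term_eq:
  assumes "2 * s \<le> r"
  shows "tail_term r s j = theta_term r s 0 j"
proof -
  define e where "e = r * j * (j + 1) div 2"
  have e: "r * (j\<^sup>2 + (2 * 0 + 1) * j) div 2 = e"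
    by (simp add: e_def algebra_simps power2_eq_square)
  have le: "s * j \<le> e"
    using exponent_ge[OF assms, of j 0] unfolding e by linarith
  have shift: "e - s * j + (2 * j * s + s) = e + (j + 1) * s"
    using le by (simp add: algebra_simps)
  have "theta_term r s 0 j
      = (-1) ^ j * (fps_X ^ (e - s * j) - fps_X ^ (e - s * j + (2 * j * s + s)))"
    unfolding theta_term_def e by (simp only: power_add) (simp add: algebra_simps)
  then show ?thesis
    unfolding shift tail_term_def e_def[symmetric] by simp
qed

lemma summable_tail_term:
  assumes "1 \<le> s" "2 * s \<le> r"
  shows "summable (\<lambda>j. tail_term r s (k + j))"
  by (rule fps_summableI) (simp add: tail_term_eq[OF assms(2)] theta_term_nth_eq_0[OF assms])

lemma has_prod_qpoch_inf:
  assumes "0 < a" "0 < m"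
  shows "(\<lambda>n. 1 - fps_X ^ a * (fps_X ^ m) ^ n) has_prod qpoch_inf (fps_X ^ a) (fps_X ^ m)"
proof -
  define f :: "nat \<Rightarrow> real fps" where "f = (\<lambda>n. 1 - fps_X ^ a * (fps_X ^ m) ^ n)"
  have step: "fps_nth (h * f i) n = fps_nth h n" if "n \<le> i" for h n i
  proof -
    have "i \<le> m * i" using \<open>0 < m\<close> by simp
    then have "n < a + m * i" using that \<open>0 < a\<close> by linarith
    moreover have "h * f i = h - fps_X ^ (a + m * i) * h"
      unfolding f_def power_add power_mult by (simp add: right_diff_distrib mult.commute)
    ultimately show ?thesis by (simp add: fps_X_power_mult_nth)
  qed
  have stable: "fps_nth (\<Prod>i\<le>N. f i) n = fps_nth (\<Prod>i\<le>n. f i) n" if "n \<le> N" for n N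
    using that by (induction N rule: dec_induct) (simp_all add: step)
  define g where "g = Abs_fps (\<lambda>n. fps_nth (\<Prod>i\<le>n. f i) n)"
  have "(\<lambda>N. \<Prod>i\<le>N. f i) \<longlonglongrightarrow> g"
  proof (rule tendsto_fpsI)
    fix n
    show "\<forall>\<^sub>F N in sequentially. fps_nth (\<Prod>i\<le>N. f i) n = fps_nth g n"
      using eventually_ge_at_top[of n] by eventually_elim (unfold g_def fps_nth_Abs_fps, rule stable)
  qed
  moreover have "fps_nth g 0 = 1"
    using \<open>0 < a\<close> by (simp add: g_def f_def)
  then have "g \<noteq> 0" by auto
  ultimately have "f has_prod g"
    by (simp add: has_prod_def raw_has_prod_def)
  moreover have "g' = g" if "f has_prod g'" for g'
  proof -
    have "f i \<noteq> 0" for i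
    proof
      assume "f i = 0"
      then have "fps_nth (f i) 0 = 0" by simp
      then show False using \<open>0 < a\<close> by (simp add: f_def)
    qed
    then have "(\<lambda>N. \<Prod>i\<le>N. f i) \<longlonglongrightarrow> g'"
      using that by (auto simp: has_prod_def raw_has_prod_def)
    then show ?thesis
      using \<open>(\<lambda>N. \<Prod>i\<le>N. f i) \<longlonglongrightarrow> g\<close> LIMSEQ_unique by blast
  qed
  ultimately have "f has_prod (THE p. f has_prod p)"
    by (rule theI)
  then show ?thesis
    by (simp add: qpoch_inf_def prodinf_def f_def)
qed

end

theory Submission
  imports Defs "HOL-Number_Theory.Cong"
begin

text \<open>
  Dividing the \<open>j\<close>-th numerator term by \<open>1 - q\<^sup>s\<close> leaves a geometric sum of length
  \<open>2 j + 2 k + 1\<close>. Since \<open>b = r - s\<close> and the third exponent \<open>c\<close> are coprime, the \<open>m\<close>-th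
  coefficient \<open>p m\<close> of \<open>1 / ((1 - q\<^sup>b) (1 - q\<^sup>c))\<close> differs from \<open>m / (b c)\<close> by at most 1. Replacing
  \<open>p\<close> by this approximation turns the coefficient of \<open>q\<^sup>n\<close> into an alternating sum of a cubic in
  \<open>x = j + k + 1/2\<close>, which is evaluated in closed form; for \<open>k \<ge> 8 r\<close> it exceeds the accumulated
  errors. The partial sums are cut after an even number of terms, a possible last term having
  positive sign.

  The tail series is \<open>(-1)\<^sup>k\<close> times a power of \<open>q\<close> times the theta series, and the infinite product
  contains the three factors of the denominator, the other factors having inverses with
  nonnegative coefficients.
\<close>

section \<open>Coefficients of 1 / ((1 - q^b) (1 - q^c))\<close>

lemma inverse_one_minus_fps_X_power:
  assumes "0 < a"
  shows "inverse (1 - fps_X ^ a :: real fps) = Abs_fps (\<lambda>n. if a dvd n then 1 else 0)"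
proof (rule fps_inverse_unique)
  show "(1 - fps_X ^ a) * Abs_fps (\<lambda>n. if a dvd n then 1 else 0 :: real) = 1"
  proof (rule fps_ext)
    fix n
    have "a dvd n - a \<longleftrightarrow> a dvd n" if "a \<le> n"
      using that by (metis dvd_minus_self not_le)
    moreover have "\<not> a dvd n" if "n < a" "0 < n"
      using that by (auto dest: dvd_imp_le)
    ultimately show "fps_nth ((1 - fps_X ^ a) * Abs_fps (\<lambda>n. if a dvd n then 1 else 0 :: real)) n = fps_nth 1 n"
      using assms by (cases "n = 0") (auto simp: left_diff_distrib fps_X_power_mult_nth)
  qed
qed

text \<open>For i0 <= m the class contributes floor((m - i0) / M) + 1 members, which is within 1 of
  m / M because 0 <= i0 < M. For m < i0 there are none, and m / M < 1.\<close>

lemma card_cong_bounds: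
  fixes m M i0 :: nat
  assumes "i0 < M"
  defines "N \<equiv> real (card {i. i \<le> m \<and> [i = i0] (mod M)})"
  shows "real m / M - 1 \<le> N" "N \<le> real m / M + 1"
proof -
  have eq: "{i. i \<le> m \<and> [i = i0] (mod M)} = (\<lambda>t. i0 + M * t) ` {t. i0 + M * t \<le> m}"
  proof -
    have "i = i0 + M * (i div M)" if "[i = i0] (mod M)" for i
      using that assms(1) by (metis add.commute cong_def mod_less mult_div_mod_eq)
    moreover have "[i0 + M * t = i0] (mod M)" for t
      by (simp add: cong_def)
    ultimately show ?thesis
      by (auto simp: image_iff) metis
  qed
  have N: "N = real (card {t. i0 + M * t \<le> m})"
    unfolding N_def eq using assms(1) by (subst card_image) (auto intro: inj_onI)
  have "real m / M - 1 \<le> N \<and> N \<le> real m / M + 1"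
  proof (cases "i0 \<le> m")
    case True
    have "i0 + M * t \<le> m \<longleftrightarrow> t \<le> (m - i0) div M" for t
      using True assms(1) by (simp add: less_eq_div_iff_mult_less_eq le_diff_conv2 mult.commute add.commute)
    then have "{t. i0 + M * t \<le> m} = {..(m - i0) div M}"
      by auto
    then have "N = real ((m - i0) div M) + 1"
      by (simp add: N)
    moreover have "real ((m - i0) div M) \<le> real (m - i0) / M"
      by (rule of_nat_div_le_of_nat)
    moreover have "real (m - i0) / M - real ((m - i0) div M) \<le> 1"
      using real_of_int_div3[of "int (m - i0)" "int M"] by (simp flip: zdiv_int)
    moreover have "real (m - i0) / M \<le> real m / M"
      by (simp add: divide_right_mono)
    moreover have "real m / M - 1 \<le> real (m - i0) / M"
      using assms(1) True by (simp add: field_simps of_nat_diff)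
    ultimately show ?thesis
      by linarith
  next
    case False
    then have "N = 0" by (simp add: N)
    moreover have "real m / M \<le> 1"
      using False assms(1) by simp
    ultimately show ?thesis
      by simp
  qed
  then show "real m / M - 1 \<le> N" "N \<le> real m / M + 1"
    by auto
qed

text \<open>The coefficient counts the i <= m with b dividing i and c dividing m - i. By the Chinese
  remainder theorem these i form a single residue class modulo b c, so the error is at most 1
  whatever the size of b and c.\<close>

lemma nth_inverse_two_factors_bounds:
  fixes b c m :: nat
  assumes "coprime b c" "0 < b" "0 < c"
  defines "p \<equiv> fps_nth (inverse (1 - fps_X ^ b) * inverse (1 - fps_X ^ c) :: real fps) m"
  shows "real m / (real b * real c) - 1 \<le> p" "p \<le> real m / (real b * real c) + 1"
proof -
  obtain i0 where i0: "i0 < b * c" "[i0 = 0] (mod b)" "[i0 = m] (mod c)"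
    using binary_chinese_remainder_unique_nat[OF assms(1), of 0 m] assms(2,3) by auto
  have iff: "b dvd i \<and> c dvd m - i \<longleftrightarrow> [i = i0] (mod b * c)" if "i \<le> m" for i
  proof -
    have "b dvd i \<and> c dvd m - i \<longleftrightarrow> [i = 0] (mod b) \<and> [i = m] (mod c)"
      using that by (metis cong_0_iff cong_altdef_nat cong_sym)
    also have "\<dots> \<longleftrightarrow> [i = i0] (mod b) \<and> [i = i0] (mod c)"
      using i0 by (meson cong_sym cong_trans)
    also have "\<dots> \<longleftrightarrow> [i = i0] (mod b * c)"
      using assms(1) by (metis cong_modulus_mult_nat coprime_cong_mult_nat mult.commute)
    finally show ?thesis .
  qed
  have "p = (\<Sum>i=0..m. if b dvd i \<and> c dvd m - i then 1 else 0)"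
    unfolding p_def by (simp add: inverse_one_minus_fps_X_power assms fps_mult_nth if_distrib cong: if_cong)
      (rule sum.cong, auto)
  also have "\<dots> = real (card {i \<in> {0..m}. b dvd i \<and> c dvd m - i})"
    by (simp add: sum.If_cases Int_def)
  also have "{i \<in> {0..m}. b dvd i \<and> c dvd m - i} = {i. i \<le> m \<and> [i = i0] (mod b * c)}"
    using iff by auto
  finally show "real m / (real b * real c) - 1 \<le> p" "p \<le> real m / (real b * real c) + 1"
    using card_cong_bounds[OF i0(1), of m] by simp_all
qed

section \<open>Products and sums in the X-adic topology\<close>

lemma fps_mult_nonneg:
  fixes f g :: "real fps"
  assumes "\<And>n. 0 \<le> fps_nth f n" "\<And>n. 0 \<le> fps_nth g n"
  shows "0 \<le> fps_nth (f * g) n"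
  unfolding fps_mult_nth using assms by (intro sum_nonneg) simp

text \<open>Convergence means that each coefficient is eventually constant, and the n-th coefficient
  of a product involves only coefficients up to n.\<close>

lemma tendsto_fps_mult_left:
  fixes g :: "'a::comm_ring_1 fps"
  assumes "(f \<longlongrightarrow> g) F"
  shows "((\<lambda>x. h * f x) \<longlongrightarrow> h * g) F"
proof (rule tendsto_fpsI)
  fix n
  have "\<forall>\<^sub>F x in F. \<forall>i\<in>{..n}. fps_nth (f x) i = fps_nth g i"
    using assms by (subst eventually_ball_finite_distrib) (auto simp: tendsto_fps_iff)
  then show "\<forall>\<^sub>F x in F. fps_nth (h * f x) n = fps_nth (h * g) n"
    by eventually_elim (auto simp: fps_mult_nth intro!: sum.cong)
qed

lemma sums_fps_mult_left:
  fixes f :: "nat \<Rightarrow> 'a::comm_ring_1 fps"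
  assumes "f sums g"
  shows "(\<lambda>j. h * f j) sums (h * g)"
  using tendsto_fps_mult_left[OF assms[unfolded sums_def], of h]
  by (simp add: sums_def sum_distrib_left)

lemma fps_nth_sums_eq_finite_sum:
  fixes f :: "nat \<Rightarrow> real fps"
  assumes "f sums g" and "\<And>j. N \<le> j \<Longrightarrow> fps_nth (f j) n = 0"
  shows "fps_nth g n = (\<Sum>j<N. fps_nth (f j) n)"
proof -
  have "\<forall>\<^sub>F m in sequentially. fps_nth (\<Sum>j<m. f j) n = fps_nth g n"
    using assms(1) by (auto simp: sums_def tendsto_fps_iff)
  then have "\<forall>\<^sub>F m in sequentially. fps_nth (\<Sum>j<m. f j) n = fps_nth g n \<and> N \<le> m"
    using eventually_ge_at_top[of N] by (rule eventually_conj)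
  then obtain m where m: "fps_nth (\<Sum>j<m. f j) n = fps_nth g n" "N \<le> m"
    using eventually_happens'[OF sequentially_bot] by blast
  have "(\<Sum>j<m. fps_nth (f j) n) = (\<Sum>j<N. fps_nth (f j) n)"
    by (rule sum.mono_neutral_right) (use m(2) assms(2) in auto)
  then show ?thesis
    using m(1) by (simp add: fps_sum_nth)
qed

section \<open>Cubic main term against accumulated errors\<close>

text \<open>Neighbours are paired: the induction step adds r (3 x^2 + 3 x + 1) - Y at x = 2 t + k +
  1/2, so the gain comes from the term - r x^3.\<close>

lemma alternating_cubic_sum:
  fixes k t :: nat and r Y :: real
  shows "(\<Sum>j<2*t. (-1) ^ j * ((real j + real k + 1/2) * (Y - r * (real j + real k + 1/2)\<^sup>2)))
    = real t * (r * ((real k + 2 * real t)\<^sup>2 + (real k + 2 * real t) * real k + (real k)\<^sup>2 - 3/4) - Y)"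
proof (induction t)
  case (Suc t)
  define x where "x = real (2 * t) + real k + 1/2"
  have "2 * Suc t = Suc (Suc (2 * t))" by simp
  then have "(\<Sum>j<2 * Suc t. (-1) ^ j * ((real j + real k + 1/2) * (Y - r * (real j + real k + 1/2)\<^sup>2)))
      = (\<Sum>j<2 * t. (-1) ^ j * ((real j + real k + 1/2) * (Y - r * (real j + real k + 1/2)\<^sup>2)))
        + x * (Y - r * x\<^sup>2) - (x + 1) * (Y - r * (x + 1)\<^sup>2)"
    by (simp only: sum.lessThan_Suc) (simp add: x_def algebra_simps)
  also have "\<dots> = real (Suc t) * (r * ((real k + 2 * real (Suc t))\<^sup>2
      + (real k + 2 * real (Suc t)) * real k + (real k)\<^sup>2 - 3/4) - Y)"
    unfolding Suc.IH by (simp add: x_def field_simps power2_eq_square)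
  finally show ?case .
qed simp

text \<open>
  Right-hand side: the cubic sum above for \<open>Y = 2 (n - s k) + r (k + 1/2)\<^sup>2\<close>, the value for which its
  terms approximate the blocks of the coefficient of \<open>q\<^sup>n\<close>. Left-hand side: \<open>b c\<close> times the sum of the interval lengths, and the loss in the last term, where
  some arguments \<open>m\<close> of \<open>p\<close> are negative and \<open>p m = 0\<close> has to be bounded by the positive number
  \<open>(n - e) / (b c) + 1\<close>, with \<open>e\<close> the exponent of that term.
\<close>

lemma approximation_dominates_error:
  fixes r s k c K t n e1 :: real
  assumes "0 < s" "2 * s < r" "24 \<le> k" "8 * r \<le> k" "0 < c" "c \<le> 2 * r" "1 \<le> t"
    and K: "K = k + 2 * t"
    and n: "2 * n \<le> r * ((2*t + 1)\<^sup>2 + (2 * k + 1) * (2*t + 1)) - 2 * s * (2*t + 1)"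
  shows "s * ((2*K - 1) * (K - 1)) + (r - s) * c * (K\<^sup>2 - k\<^sup>2)
    \<le> t * (r * (K\<^sup>2 + K * k + k\<^sup>2 - 3/4) - (2 * (n - s * k) + r * (k + 1/2)\<^sup>2))"
proof -
  \<comment> \<open>Completing the square: (2 t + 1)^2 + (2 k + 1) (2 t + 1) + (k + 1/2)^2 = (K +
    3/2)^2. The terms with s are negative and dropped.\<close>
  have "2 * (n - s * k) + r * (k + 1/2)\<^sup>2 \<le> r * (K + 3/2)\<^sup>2"
  proof -
    have "0 \<le> s * (2 * t + 1) + s * k" using assms by simp
    then show ?thesis using n unfolding K by (simp add: algebra_simps power2_eq_square)
  qed
  then have "r * (k * (K + k) - 3 * (K + 1)) \<le> r * (K\<^sup>2 + K * k + k\<^sup>2 - 3/4) - (2 * (n - s * k) + r * (k + 1/2)\<^sup>2)"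
    by (simp add: algebra_simps power2_eq_square)
  then have 1: "t * (r * (k * (K + k) - 3 * (K + 1))) \<le> t * (r * (K\<^sup>2 + K * k + k\<^sup>2 - 3/4) - (2 * (n - s * k) + r * (k + 1/2)\<^sup>2))"
    using assms by (intro mult_left_mono) auto
  have kK: "0 \<le> t * (k * (K + k))" using assms by simp
  \<comment> \<open>The bound k >= 8 r enters here, as 2 c <= 4 r <= k / 2: the interval errors cost
    at most half of the main term.\<close>
  have "(r - s) * c * (K\<^sup>2 - k\<^sup>2) = (r - s) * (t * (K + k)) * (2 * c)"
    unfolding K by (simp add: algebra_simps power2_eq_square)
  also have "\<dots> \<le> (r - s) * (t * (K + k)) * (k / 2)"
    using assms by (intro mult_left_mono) auto
  finally have 2: "(r - s) * c * (K\<^sup>2 - k\<^sup>2) \<le> (r - s) * (t * (k * (K + k)) / 2)"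
    by (simp add: algebra_simps)
  have 3: "s * ((2*K - 1) * (K - 1)) \<le> s * (2 * K\<^sup>2)"
    using assms by (intro mult_left_mono) (auto simp: algebra_simps power2_eq_square)
  \<comment> \<open>In the application r >= 3, hence k >= 8 r >= 24, which is enough to absorb the
    terms of lower order in k.\<close>
  have q: "2 * K\<^sup>2 + 6 * t * (K + 1) \<le> 3/2 * (t * (k * (K + k)))"
  proof -
    have a: "k * k \<le> t * (k * k)" "24 * t * k \<le> t * (k * k)" "24 * t * t \<le> t * t * k" "t \<le> t * k" "t \<le> t * t"
      using assms by (auto simp: mult_ac intro!: mult_mono) 
    have "2 * K\<^sup>2 + 6 * t * (K + 1) = 2 * (k * k) + 8 * t * k + 8 * (t*t) + 6 * t * k + 12 * (t * t) + 6 * t"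
      unfolding K by (simp add: algebra_simps power2_eq_square)
    moreover have "3/2 * (t * (k * (K + k))) = 3 * (t * (k * k)) + 3 * (t * t * k)"
      unfolding K by (simp add: algebra_simps power2_eq_square)
    ultimately show ?thesis using a \<open>1 \<le> t\<close> by linarith
  qed
  \<comment> \<open>With P = t k (K + k) and Q = 3 t (K + 1) this says s (2 K^2 - P / 2) <= r (P / 2
    - Q). If the factor of s is positive, s < r / 2 reduces the claim to \<open>q\<close>; otherwise
    Q <= P / 2 suffices.\<close>
  have "s * (2 * K\<^sup>2) \<le> r * (t * (k * (K + k)) - 3 * t * (K + 1)) - (r - s) * (t * (k * (K + k)) / 2)"
  proof -
    have "s * (2 * K\<^sup>2 - t * (k * (K + k)) / 2) \<le> r * ((t * (k * (K + k)) / 2 - 3 * t * (K + 1)))"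
    proof (cases "2 * K\<^sup>2 - t * (k * (K + k)) / 2 \<le> 0")
      case True
      have "0 \<le> t * (k * (K + k)) / 2 - 3 * t * (K + 1)"
      proof -
        have "6 * (K + 1) \<le> 24 * (K + k)"
          using assms by simp
        also have "\<dots> \<le> k * (K + k)"
          using assms by (intro mult_right_mono) auto
        finally have "t * (6 * (K + 1)) \<le> t * (k * (K + k))"
          using assms by (intro mult_left_mono) auto
        then show ?thesis by (simp add: algebra_simps)
      qed
      then show ?thesis
        using True assms by (smt (verit) mult_nonneg_nonneg mult_nonneg_nonpos)
    next
      case False
      then have "s * (2 * K\<^sup>2 - t * (k * (K + k)) / 2) \<le> r / 2 * (2 * K\<^sup>2 - t * (k * (K + k)) / 2)"
        using assms by (intro mult_right_mono) auto
      also have "\<dots> = r * (K\<^sup>2 - t * (k * (K + k)) / 4)" by (simp add: algebra_simps)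
      also have "\<dots> \<le> r * ((t * (k * (K + k)) / 2 - 3 * t * (K + 1)))"
        using q assms by (intro mult_left_mono) auto
      finally show ?thesis .
    qed
    moreover have "s * Z \<le> r * (P - Q) - (r - s) * (P / 2)" if "s * (Z - P / 2) \<le> r * (P / 2 - Q)" for P Q Z
      using that by (simp add: field_simps)
    ultimately show ?thesis by blast
  qed
  moreover have "t * (r * (k * (K + k) - 3 * (K + 1))) = r * (t * (k * (K + k)) - 3 * t * (K + 1))"
    by (simp add: algebra_simps)
  ultimately show ?thesis using 1 2 3 by linarith
qed

section \<open>Exponents and blocks of the theta series\<close>

definition theta_exp :: "nat \<Rightarrow> nat \<Rightarrow> nat \<Rightarrow> nat \<Rightarrow> nat" where
  "theta_exp r s k j = r * (j\<^sup>2 + (2 * k + 1) * j) div 2 - s * j"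

text \<open>Up to the sign (-1)^j, this is the contribution of the j-th theta term to the
  coefficient of q^n. The test encodes p m = 0 for negative m, where truncated subtraction would
  give p 0.\<close>

definition theta_block :: "(nat \<Rightarrow> real) \<Rightarrow> nat \<Rightarrow> nat \<Rightarrow> nat \<Rightarrow> nat \<Rightarrow> nat \<Rightarrow> real" where
  "theta_block p r s k n j =
     (\<Sum>i<2 * j + 2 * k + 1. if theta_exp r s k j + s * i \<le> n then p (n - theta_exp r s k j - s * i) else 0)"

lemma real_theta_exp:
  assumes "2 * s \<le> r"
  shows "real (theta_exp r s k j)
    = real r * ((real j)\<^sup>2 + (2 * real k + 1) * real j) / 2 - real s * real j"
  unfolding theta_exp_def by (rule theta_exponent[OF assms])

text \<open>
  The geometric sum of one term ends before the next term starts. Hence only the last block that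
  contributes to a given coefficient is truncated.
\<close>

lemma theta_exp_step:
  assumes "2 * s \<le> r"
  shows "theta_exp r s k j + s * (2 * j + 2 * k + 1) \<le> theta_exp r s k (Suc j)"
proof -
  have "(2 * real s) * (real j + real k + 1) \<le> real r * (real j + real k + 1)"
    using assms by (intro mult_right_mono) auto
  then have "real (theta_exp r s k j + s * (2 * j + 2 * k + 1)) \<le> real (theta_exp r s k (Suc j))"
    by (simp add: real_theta_exp[OF assms] field_simps power2_eq_square)
  then show ?thesis
    by linarith
qed

lemma theta_exp_mono:
  assumes "2 * s \<le> r" "i \<le> j"
  shows "theta_exp r s k i \<le> theta_exp r s k j"
  using assms(2)
proof (rule lift_Suc_mono_le[rotated])
  show "theta_exp r s k j \<le> theta_exp r s k (Suc j)" for j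
    using theta_exp_step[OF assms(1), of k j] by linarith
qed

lemma sum_affine:
  fixes A B s d :: real
  shows "(\<Sum>i<L. (A - s * real i) / B + d) = (real L * A - s * real L * (real L - 1) / 2) / B + real L * d"
proof (induction L)
  case (Suc L)
  have "(real L * A - s * real L * (real L - 1) / 2) + (A - s * real L)
      = real (Suc L) * A - s * real (Suc L) * (real (Suc L) - 1) / 2"
    by (simp add: field_simps)
  then have "(real L * A - s * real L * (real L - 1) / 2) / B + (A - s * real L) / B
      = (real (Suc L) * A - s * real (Suc L) * (real (Suc L) - 1) / 2) / B"
    by (simp only: add_divide_distrib[symmetric])
  then show ?case
    using Suc.IH by (simp add: distrib_right)
qed simp

lemma theta_block_nonneg:
  assumes "\<And>m. 0 \<le> p m"
  shows "0 \<le> theta_block p r s k n j"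
  unfolding theta_block_def by (intro sum_nonneg) (auto simp: assms)

text \<open>\<open>h\<close> is the block sum with p m replaced by m / B; each of the L summands
  then errs by at most 1.\<close>

lemma theta_block_full_bounds:
  fixes p :: "nat \<Rightarrow> real" and B :: real
  assumes p: "\<And>m. real m / B - 1 \<le> p m" "\<And>m. p m \<le> real m / B + 1"
    and n: "theta_exp r s k j + s * (2 * j + 2 * k + 1) \<le> n"
  defines "L \<equiv> real (2 * j + 2 * k + 1)"
  defines "h \<equiv> (L * (real n - real (theta_exp r s k j)) - real s * L * (L - 1) / 2) / B"
  shows "h - L \<le> theta_block p r s k n j" "theta_block p r s k n j \<le> h + L"
proof -
  let ?a = "\<lambda>i. (real n - real (theta_exp r s k j) - real s * real i) / B"
  have le: "theta_exp r s k j + s * i \<le> n" if "i < 2 * j + 2 * k + 1" for i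
    using that n mult_le_mono2[of i "2 * j + 2 * k + 1" s] by linarith
  then have eq: "theta_block p r s k n j = (\<Sum>i<2 * j + 2 * k + 1. p (n - theta_exp r s k j - s * i))"
    unfolding theta_block_def by (intro sum.cong) auto
  have real: "real (n - theta_exp r s k j - s * i) = real n - real (theta_exp r s k j) - real s * real i"
    if "i < 2 * j + 2 * k + 1" for i
    using le[OF that] by (simp add: of_nat_diff)
  have "h + L * (- 1) = (\<Sum>i<2 * j + 2 * k + 1. ?a i + (- 1))"
    unfolding sum_affine h_def L_def ..
  also have "\<dots> \<le> theta_block p r s k n j"
    unfolding eq using p(1) real by (intro sum_mono) (metis lessThan_iff uminus_add_conv_diff add.commute)
  finally show "h - L \<le> theta_block p r s k n j" by simp
  have "theta_block p r s k n j \<le> (\<Sum>i<2 * j + 2 * k + 1. ?a i + 1)"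
    unfolding eq using p(2) real by (intro sum_mono) (metis lessThan_iff)
  also have "\<dots> = h + L * 1"
    unfolding sum_affine h_def L_def ..
  finally show "theta_block p r s k n j \<le> h + L" by simp
qed

text \<open>Meant for a block that n may cut off: every summand is bounded by the estimate at i = 0,
  which also bounds the missing summands because it is nonnegative.\<close>

lemma theta_block_le:
  fixes p :: "nat \<Rightarrow> real" and B :: real
  assumes p: "\<And>m. p m \<le> real m / B + 1" and "0 < B"
    and n: "theta_exp r s k j \<le> n"
  shows "theta_block p r s k n j
    \<le> real (2 * j + 2 * k + 1) * ((real n - real (theta_exp r s k j)) / B + 1)"
proof -
  let ?A = "(real n - real (theta_exp r s k j)) / B + 1"
  have "(if theta_exp r s k j + s * i \<le> n then p (n - theta_exp r s k j - s * i) else 0) \<le> ?A" for i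
  proof -
    have "p (n - theta_exp r s k j - s * i) \<le> ?A" if "theta_exp r s k j + s * i \<le> n"
    proof -
      have "p (n - theta_exp r s k j - s * i) \<le> real (n - theta_exp r s k j - s * i) / B + 1"
        by (rule p)
      also have "\<dots> \<le> ?A"
        using that \<open>0 < B\<close> by (simp add: divide_right_mono)
      finally show ?thesis .
    qed
    moreover have "0 \<le> ?A" using n \<open>0 < B\<close> by simp
    ultimately show ?thesis by simp
  qed
  then have "theta_block p r s k n j \<le> (\<Sum>i<2 * j + 2 * k + 1. ?A)"
    unfolding theta_block_def by (intro sum_mono) blast
  then show ?thesis by (simp only: sum_constant card_lessThan)
qed

section \<open>Sign of the alternating block sum\<close>

text \<open>The range of n makes the blocks before index 2 t - 1 complete, so the two-sided bounds
  apply to them. The block at 2 t - 1 has negative sign and needs only an upper bound.\<close>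

lemma alternating_theta_block_sum_nonneg:
  fixes p :: "nat \<Rightarrow> real" and r s k c t n :: nat
  assumes s: "1 \<le> s" "2 * s < r" and k: "8 * r \<le> k" and c: "0 < c" "c \<le> 2 * r"
    and p: "\<And>m. real m / (real (r - s) * real c) - 1 \<le> p m"
      "\<And>m. p m \<le> real m / (real (r - s) * real c) + 1"
    and t: "1 \<le> t" and n: "theta_exp r s k (2 * t - 1) \<le> n" "n < theta_exp r s k (2 * t + 1)"
  shows "0 \<le> (\<Sum>j<2*t. (-1) ^ j * theta_block p r s k n j)"
proof -
  define B where "B = real (r - s) * real c"
  define K where "K = real k + 2 * real t"
  define Y where "Y = 2 * (real n - real s * real k) + real r * (real k + 1/2)\<^sup>2"
  define x where "x j = real j + real k + 1/2" for j
  define g where "g j = x j * (Y - real r * (x j)\<^sup>2)" for j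
  \<comment> \<open>The upper bound for the last block forgets the shifts s i. Its length is 2 K -
    1, and the sum of i below 2 K - 1 is (2 K - 1) (K - 1).\<close>
  define last where "last j = (if j = 2 * t - 1 then real s * ((2 * K - 1) * (K - 1)) / B else 0)" for j
  have rs: "2 * s \<le> r" using s by simp
  have B: "0 < B" using s c by (simp add: B_def)
  note pB = p[folded B_def]
  have L: "real (2 * j + 2 * k + 1) = 2 * x j" for j
    by (simp add: x_def)
  \<comment> \<open>The mean shift in a block is s (j + k), and the exponent contains - s j. So s
    enters only through the constant s k, and a pure cubic in x remains.\<close>
  have h: "(2 * x j * (real n - real (theta_exp r s k j)) - real s * (2 * x j) * (2 * x j - 1) / 2) / B = g j / B" for j
    unfolding g_def Y_def real_theta_exp[OF rs] x_def by (simp add: field_simps power2_eq_square)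
  have full: "theta_exp r s k j + s * (2 * j + 2 * k + 1) \<le> n" if "j < 2 * t - 1" for j
    using theta_exp_step[OF rs, of k j] theta_exp_mono[OF rs, of "Suc j" "2 * t - 1" k] that n(1)
    by simp
  have "(-1) ^ j * g j / B - 2 * x j - last j \<le> (-1) ^ j * theta_block p r s k n j"
    if "j < 2 * t" for j
  proof (cases "j = 2 * t - 1")
    case True
    then have "odd j" using t by simp
    have K: "K = x j + 1/2"
      using True t by (simp add: x_def K_def of_nat_diff)
    have "(2 * K - 1) * (K - 1) = 2 * x j * (2 * x j - 1) / 2"
      unfolding K by (simp add: algebra_simps)
    then have "last j = (real s * (2 * x j) * (2 * x j - 1) / 2) / B"
      using True by (simp only: last_def if_True) simp
    then have "g j / B + last j = 2 * x j * (real n - real (theta_exp r s k j)) / B"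
      unfolding h[symmetric] by (simp add: diff_divide_distrib)
    moreover have "theta_block p r s k n j \<le> 2 * x j * ((real n - real (theta_exp r s k j)) / B + 1)"
      using theta_block_le[of p B r s k j n, OF pB(2) B] n(1) unfolding L True by simp
    ultimately show ?thesis
      using \<open>odd j\<close> by (simp add: algebra_simps)
  next
    case False
    then have j: "j < 2 * t - 1" using that by simp
    show ?thesis
      using theta_block_full_bounds[of B p, OF pB full[OF j], unfolded L h] False
      by (cases "even j") (simp_all add: last_def)
  qed
  then have "(\<Sum>j<2*t. (-1) ^ j * g j / B - 2 * x j - last j) \<le> (\<Sum>j<2*t. (-1) ^ j * theta_block p r s k n j)"
    by (intro sum_mono) simp
  moreover have "0 \<le> (\<Sum>j<2*t. (-1) ^ j * g j / B - 2 * x j - last j)"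
  proof -
    have "(\<Sum>j<2*t. (-1) ^ j * g j / B) = (\<Sum>j<2*t. (-1) ^ j * g j) / B"
      by (simp add: sum_divide_distrib)
    also have "(\<Sum>j<2*t. (-1) ^ j * g j) = real t * (real r * (K\<^sup>2 + K * real k + (real k)\<^sup>2 - 3/4) - Y)"
      unfolding g_def x_def K_def by (rule alternating_cubic_sum)
    finally have 1: "(\<Sum>j<2*t. (-1) ^ j * g j / B) = real t * (real r * (K\<^sup>2 + K * real k + (real k)\<^sup>2 - 3/4) - Y) / B" .
    \<comment> \<open>Block lengths are consecutive odd numbers, that is, differences of consecutive
      squares.\<close>
    have "(\<Sum>j<N. 2 * x j) = (real k + real N)\<^sup>2 - (real k)\<^sup>2" for N
      by (induction N) (simp_all add: x_def algebra_simps power2_eq_square)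
    from this[of "2 * t"] have 2: "(\<Sum>j<2*t. 2 * x j) = B * (K\<^sup>2 - (real k)\<^sup>2) / B"
      using B by (simp add: K_def)
    have 3: "(\<Sum>j<2*t. last j) = real s * ((2 * K - 1) * (K - 1)) / B"
      using t by (simp add: last_def)
    have "real s * ((2 * K - 1) * (K - 1)) + (real r - real s) * real c * (K\<^sup>2 - (real k)\<^sup>2)
      \<le> real t * (real r * (K\<^sup>2 + K * real k + (real k)\<^sup>2 - 3/4) - (2 * (real n - real s * real k) + real r * (real k + 1/2)\<^sup>2))"
    proof (rule approximation_dominates_error)
      have "real n \<le> real (theta_exp r s k (2 * t + 1))"
        using n(2) by simp
      then show "2 * real n \<le> real r * ((2 * real t + 1)\<^sup>2 + (2 * real k + 1) * (2 * real t + 1)) - 2 * real s * (2 * real t + 1)"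
        unfolding real_theta_exp[OF rs] of_nat_add of_nat_mult of_nat_numeral of_nat_1 by linarith
    qed (use s k c t in \<open>simp_all add: K_def\<close>)
    then have "0 \<le> (real t * (real r * (K\<^sup>2 + K * real k + (real k)\<^sup>2 - 3/4) - Y)
        - B * (K\<^sup>2 - (real k)\<^sup>2) - real s * ((2 * K - 1) * (K - 1))) / B"
      using B s by (intro divide_nonneg_pos) (simp_all add: Y_def B_def of_nat_diff)
    then show ?thesis
      unfolding sum_subtractf 1 2 3 by (simp add: diff_divide_distrib)
  qed
  ultimately show ?thesis by linarith
qed

section \<open>Theta terms and tail series as power series\<close>

lemma fps_nth_theta_term_times_inverse:
  assumes "0 < s"
  shows "fps_nth (theta_term r s k j * (inverse (1 - fps_X ^ s) * V)) n
    = (-1) ^ j * theta_block (fps_nth V) r s k n j"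
proof -
  have "(1 - fps_X ^ s) * inverse (1 - fps_X ^ s :: real fps) = 1"
    using assms by (intro inverse_mult_eq_1') simp
  moreover have "1 - (fps_X :: real fps) ^ (2 * j * s + (2 * k + 1) * s)
      = (1 - fps_X ^ s) * (\<Sum>i<2 * j + 2 * k + 1. fps_X ^ (s * i))"
  proof -
    have "2 * j * s + (2 * k + 1) * s = s * (2 * j + 2 * k + 1)"
      by (simp add: algebra_simps)
    then show ?thesis
      using one_diff_power_eq[of "fps_X ^ s :: real fps" "2 * j + 2 * k + 1"]
      by (simp only: power_mult)
  qed
  ultimately have "(1 - fps_X ^ (2 * j * s + (2 * k + 1) * s)) * inverse (1 - fps_X ^ s :: real fps)
      = (\<Sum>i<2 * j + 2 * k + 1. fps_X ^ (s * i))"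
    by (simp add: mult_ac)
  then have "theta_term r s k j * (inverse (1 - fps_X ^ s) * V)
      = (-1) ^ j * (\<Sum>i<2 * j + 2 * k + 1. fps_X ^ (theta_exp r s k j + s * i) * V)"
    unfolding theta_term_def theta_exp_def[symmetric]
    by (simp only: power_add sum_distrib_right sum_distrib_left mult_ac)
  moreover have "fps_nth ((-1) ^ j * W) n = (-1) ^ j * fps_nth W n" for W :: "real fps"
    by (cases "even j") simp_all
  ultimately show ?thesis
    by (auto simp: theta_block_def fps_sum_nth fps_X_power_mult_nth diff_diff_left
        simp del: sum.lessThan_Suc intro!: sum.cong)
qed

text \<open>Shifting the index by k splits the exponent into its value at k and
  \<open>theta_exp r s k j\<close>; the cross term r k j accounts for 2 k + 1 in place of 1.\<close>

lemma tail_sum_eq: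
  assumes "1 \<le> s" "2 * s \<le> r"
  shows "(-1) ^ k * tail_sum r s k = fps_X ^ theta_exp r s 0 k * theta_sum r s k"
proof -
  have "(-1) ^ k * tail_term r s (k + j) = fps_X ^ theta_exp r s 0 k * theta_term r s k j" for j
  proof -
    have "real (theta_exp r s 0 (k + j)) = real (theta_exp r s 0 k + theta_exp r s k j)"
      by (simp add: real_theta_exp[OF assms(2)] field_simps power2_eq_square)
    then have e: "theta_exp r s 0 (k + j) = theta_exp r s 0 k + theta_exp r s k j"
      by linarith
    have f: "2 * (k + j) * s + (2 * 0 + 1) * s = 2 * j * s + (2 * k + 1) * s"
      by (simp add: algebra_simps)
    show ?thesis
      unfolding tail_term_eq[OF assms(2)] theta_term_def theta_exp_def[symmetric] e f
      by (simp add: power_add mult_ac flip: power_mult_distrib)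
  qed
  moreover have "(\<lambda>j. (-1) ^ k * tail_term r s (k + j)) sums ((-1) ^ k * tail_sum r s k)"
    unfolding tail_sum_def by (intro sums_fps_mult_left summable_sums summable_tail_term assms)
  moreover have "(\<lambda>j. fps_X ^ theta_exp r s 0 k * theta_term r s k j)
      sums (fps_X ^ theta_exp r s 0 k * theta_sum r s k)"
    unfolding theta_sum_def by (intro sums_fps_mult_left summable_sums summable_theta_term assms)
  ultimately show ?thesis
    by (simp add: sums_unique2)
qed

section \<open>Infinite products\<close>

lemma qpoch_inf_LIMSEQ:
  assumes "0 < a" "0 < m"
  shows "(\<lambda>N. \<Prod>i\<le>N. 1 - fps_X ^ (a + m * i)) \<longlonglongrightarrow> qpoch_inf (fps_X ^ a) (fps_X ^ m)"
proof -
  define f :: "nat \<Rightarrow> real fps" where "f = (\<lambda>i. 1 - fps_X ^ a * (fps_X ^ m) ^ i)"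
  have f: "f i = 1 - fps_X ^ (a + m * i)" for i
    by (simp add: f_def power_add power_mult)
  \<comment> \<open>\<open>has_prod\<close> allows finitely many zero factors to be set aside; as no
    factor vanishes, the plain partial products converge to the value.\<close>
  have "f i \<noteq> 0" for i
  proof
    assume "f i = 0"
    then have "fps_nth (f i) 0 = 0" by simp
    then show False using \<open>0 < a\<close> by (simp add: f_def)
  qed
  then have "(\<lambda>N. \<Prod>i\<le>N. f i) \<longlonglongrightarrow> qpoch_inf (fps_X ^ a) (fps_X ^ m)"
    using has_prod_qpoch_inf[OF assms, folded f_def]
    by (auto simp: has_prod_def raw_has_prod_def)
  then show ?thesis unfolding f .
qed

lemma fps_nth_0_qpoch_inf:
  assumes "0 < a" "0 < m"
  shows "fps_nth (qpoch_inf (fps_X ^ a) (fps_X ^ m)) 0 = 1"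
proof -
  have "fps_nth (\<Prod>i\<le>N. 1 - fps_X ^ (a + m * i) :: real fps) 0 = 1" for N
    using assms by (induction N) simp_all
  moreover have "\<forall>\<^sub>F N in sequentially. fps_nth (\<Prod>i\<le>N. 1 - fps_X ^ (a + m * i)) 0
      = fps_nth (qpoch_inf (fps_X ^ a) (fps_X ^ m)) 0"
    using qpoch_inf_LIMSEQ[OF assms] by (simp only: tendsto_fps_iff)
  ultimately show ?thesis
    by simp
qed

lemma qpoch_inf_unfold:
  assumes "0 < a" "0 < m"
  shows "qpoch_inf (fps_X ^ a) (fps_X ^ m) = (1 - fps_X ^ a) * qpoch_inf (fps_X ^ (a + m)) (fps_X ^ m)"
proof (rule LIMSEQ_unique)
  show "(\<lambda>N. \<Prod>i\<le>Suc N. 1 - fps_X ^ (a + m * i)) \<longlonglongrightarrow> qpoch_inf (fps_X ^ a) (fps_X ^ m)"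
    using qpoch_inf_LIMSEQ[OF assms] by (rule LIMSEQ_Suc)
  have "(\<Prod>i\<le>Suc N. 1 - fps_X ^ (a + m * i)) = (1 - fps_X ^ a) * (\<Prod>i\<le>N. 1 - fps_X ^ (a + m + m * i) :: real fps)" for N
    by (subst prod.atMost_Suc_shift) (simp add: add.assoc)
  then show "(\<lambda>N. \<Prod>i\<le>Suc N. 1 - fps_X ^ (a + m * i))
      \<longlonglongrightarrow> (1 - fps_X ^ a) * qpoch_inf (fps_X ^ (a + m)) (fps_X ^ m)"
    using tendsto_fps_mult_left[OF qpoch_inf_LIMSEQ[of "a + m" m]] assms by simp
qed

text \<open>Inverses of partial products are products of geometric series. Inversion is continuous
  here, so each coefficient of the limit is attained by some partial product.\<close>

lemma inverse_qpoch_inf_nonneg: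
  assumes "0 < a" "0 < m"
  shows "0 \<le> fps_nth (inverse (qpoch_inf (fps_X ^ a) (fps_X ^ m))) n"
proof -
  have "0 \<le> fps_nth (inverse (\<Prod>i\<le>N. 1 - fps_X ^ (a + m * i) :: real fps)) n" for N n
  proof (induction N arbitrary: n)
    case 0
    then show ?case using assms by (simp add: inverse_one_minus_fps_X_power)
  next
    case (Suc N)
    have "0 \<le> fps_nth (inverse (1 - fps_X ^ (a + m * Suc N)) :: real fps) n" for n
      using assms by (subst inverse_one_minus_fps_X_power) simp_all
    then show ?case
      unfolding prod.atMost_Suc fps_inverse_mult using Suc.IH by (intro fps_mult_nonneg)
  qed
  moreover have "(\<lambda>N. inverse (\<Prod>i\<le>N. 1 - fps_X ^ (a + m * i)))
      \<longlonglongrightarrow> inverse (qpoch_inf (fps_X ^ a) (fps_X ^ m))"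
    by (intro tendsto_inverse_fps qpoch_inf_LIMSEQ assms) (simp add: fps_nth_0_qpoch_inf assms)
  then have "\<forall>\<^sub>F N in sequentially. fps_nth (inverse (\<Prod>i\<le>N. 1 - fps_X ^ (a + m * i))) n
      = fps_nth (inverse (qpoch_inf (fps_X ^ a) (fps_X ^ m))) n"
    by (simp add: tendsto_fps_iff)
  then obtain N where "fps_nth (inverse (\<Prod>i\<le>N. 1 - fps_X ^ (a + m * i))) n
      = fps_nth (inverse (qpoch_inf (fps_X ^ a) (fps_X ^ m))) n"
    using eventually_happens'[OF sequentially_bot] by blast
  ultimately show ?thesis by metis
qed

section \<open>Nonnegativity of the quotients\<close>

text \<open>\<open>D\<close> stands for the three factors of the finite denominator,
  \<open>R\<close> for the rest of the infinite product.\<close>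

lemma tail_quotient_nonneg:
  fixes D R :: "real fps"
  assumes "1 \<le> s" "2 * s \<le> r"
    and D: "fps_nth D 0 \<noteq> 0" "\<And>n. 0 \<le> fps_nth (theta_sum r s k / D) n"
    and R: "fps_nth R 0 \<noteq> 0" "\<And>n. 0 \<le> fps_nth (inverse R) n"
  shows "0 \<le> fps_nth ((-1) ^ k * (tail_sum r s k / (D * R))) n"
proof -
  have "(-1) ^ k * (tail_sum r s k / (D * R))
      = fps_X ^ theta_exp r s 0 k * (theta_sum r s k / D * inverse R)"
    using tail_sum_eq[OF assms(1,2), of k] D(1) R(1)
    by (simp add: fps_divide_unit fps_inverse_mult mult_ac)
  moreover have "0 \<le> fps_nth (theta_sum r s k / D * inverse R) m" for m
    using D(2) R(2) by (rule fps_mult_nonneg)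
  ultimately show ?thesis
    by (simp add: fps_X_power_mult_nth)
qed

text \<open>Both cases are covered at once: \<open>c\<close> is r + s or 2 r - s.\<close>

lemma theta_quotient_nonneg:
  fixes r s k c n :: nat
  assumes s: "1 \<le> s" "2 * s < r" and k: "8 * r \<le> k" and c: "0 < c" "c \<le> 2 * r"
    and "coprime (r - s) c"
  shows "0 \<le> fps_nth (theta_sum r s k / ((1 - fps_X ^ s) * (1 - fps_X ^ (r - s)) * (1 - fps_X ^ c))) n"
proof -
  define V :: "real fps" where "V = inverse (1 - fps_X ^ (r - s)) * inverse (1 - fps_X ^ c)"
  define U where "U = inverse (1 - fps_X ^ s) * V"
  let ?d = "theta_block (fps_nth V) r s k n"
  have rs: "2 * s \<le> r" "0 < r - s" using s by auto
  have V: "real m / (real (r - s) * real c) - 1 \<le> fps_nth V m"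
      "fps_nth V m \<le> real m / (real (r - s) * real c) + 1" for m
    unfolding V_def by (intro nth_inverse_two_factors_bounds assms rs)+
  have "0 \<le> fps_nth V m" for m
    unfolding V_def using rs(2) c(1)
    by (intro fps_mult_nonneg) (simp_all add: inverse_one_minus_fps_X_power)
  then have d_nonneg: "0 \<le> ?d j" for j
    by (rule theta_block_nonneg)
  have grow: "j \<le> theta_exp r s k j" for j
  proof (induction j)
    case (Suc j)
    have "1 \<le> s * (2 * j + 2 * k + 1)"
      using s(1) by simp
    then show ?case
      using Suc theta_exp_step[OF rs(1), of k j] by linarith
  qed simp
  have "n < theta_exp r s k (2 * n + 1)"
    using grow[of "2 * n + 1"] by linarith
  then have "\<exists>t. n < theta_exp r s k (2 * t + 1)" ..
  \<comment> \<open>Terms from index 2 t + 1 on start beyond q^n. By minimality the term at 2 t - 1,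
    if t > 0, starts at or before q^n.\<close>
  then obtain t where t: "n < theta_exp r s k (2 * t + 1)"
      and least: "\<And>t'. t' < t \<Longrightarrow> \<not> n < theta_exp r s k (2 * t' + 1)"
    using exists_least_iff[of "\<lambda>t. n < theta_exp r s k (2 * t + 1)"] by blast
  have coeff: "fps_nth (U * theta_term r s k j) n = (-1) ^ j * ?d j" for j
    using fps_nth_theta_term_times_inverse[of s r k j V n] s(1) by (simp add: U_def mult.commute)
  have "fps_nth (U * theta_sum r s k) n = (\<Sum>j<2 * t + 1. fps_nth (U * theta_term r s k j) n)"
  proof (rule fps_nth_sums_eq_finite_sum)
    show "(\<lambda>j. U * theta_term r s k j) sums (U * theta_sum r s k)"
      unfolding theta_sum_def by (intro sums_fps_mult_left summable_sums summable_theta_term s(1) rs(1))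
    fix j assume "2 * t + 1 \<le> j"
    then have "n < theta_exp r s k j"
      using t theta_exp_mono[OF rs(1), of "2 * t + 1" j k] by linarith
    then have "?d j = 0"
      by (simp add: theta_block_def)
    then show "fps_nth (U * theta_term r s k j) n = 0"
      unfolding coeff by simp
  qed
  also have "\<dots> = (\<Sum>j<2 * t. (-1) ^ j * ?d j) + ?d (2 * t)"
    unfolding coeff by simp
  finally have eq: "fps_nth (U * theta_sum r s k) n = (\<Sum>j<2 * t. (-1) ^ j * ?d j) + ?d (2 * t)" .
  have "0 \<le> (\<Sum>j<2 * t. (-1) ^ j * ?d j)"
  proof (cases t)
    case (Suc u)
    have "theta_exp r s k (2 * t - 1) \<le> n"
      using least[of u] Suc by simp
    then show ?thesis
      using Suc t by (intro alternating_theta_block_sum_nonneg[OF s k c V]) auto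
  qed simp
  then have "0 \<le> fps_nth (U * theta_sum r s k) n"
    unfolding eq using d_nonneg[of "2 * t"] by linarith
  moreover have "theta_sum r s k / ((1 - fps_X ^ s) * (1 - fps_X ^ (r - s)) * (1 - fps_X ^ c))
      = U * theta_sum r s k"
  proof (subst fps_divide_unit)
    show "fps_nth ((1 - fps_X ^ s) * (1 - fps_X ^ (r - s)) * (1 - fps_X ^ c) :: real fps) 0 \<noteq> 0"
      using s(1) c(1) rs(2) by simp
  qed (simp only: U_def V_def fps_inverse_mult mult_ac)
  ultimately show ?thesis by simp
qed

text \<open>With a = 4 or a = 8 this covers both thresholds. Each is at least a s r, since s (r - 2
  s) <= a s^2 r^2.\<close>

lemma k_lower_bound:
  fixes r s k a :: real
  assumes "0 < s" "2 * s < r" "1 \<le> r" "8 \<le> a * s"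
    and k: "k > (a * r ^ 3 * s - 2 * s * (r - 2 * s)) / (r * (r - 2 * s))"
  shows "8 * r \<le> k"
proof -
  have pos: "0 < r * (r - 2 * s)" using assms by simp
  have "r \<le> r * r"
    using mult_left_mono[of 1 r r] assms(3) by simp
  then have "s * (r - 2 * s) \<le> s * (r * r)"
    using assms(1,2) by (intro mult_left_mono) linarith+
  also have "\<dots> \<le> (a * s) * (s * (r * r))"
    using assms mult_right_mono[of 1 "a * s" "s * (r * r)"] by simp
  finally have "(a * s * r) * (r * (r - 2 * s)) \<le> a * r ^ 3 * s - 2 * s * (r - 2 * s)"
    by (simp add: algebra_simps power3_eq_cube)
  also have "\<dots> < k * (r * (r - 2 * s))"
    using k pos by (simp add: pos_divide_less_eq)
  finally have "a * s * r < k"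
    using pos by (metis mult_less_cancel_right_pos)
  moreover have "8 * r \<le> a * s * r"
    using assms by (intro mult_right_mono) auto
  ultimately show ?thesis by simp
qed

theorem corollary1p9:
  fixes r s k :: nat
  assumes "coprime r s"
    and "1 \<le> s" "real s < real r / 2"
    and "1 \<le> k"
  shows "(even s \<and>
           real k > (4 * real r ^ 3 * real s - 2 * real s * (real r - 2 * real s))
                      / (real r * (real r - 2 * real s)) \<longrightarrow>
         (\<forall>n. fps_nth (theta_sum r s k /
                 ((1 - fps_X ^ s) * (1 - fps_X ^ (r - s)) * (1 - fps_X ^ (r + s)))) n \<ge> 0) \<and>
         (\<forall>n. fps_nth ((-1) ^ k *
                 (tail_sum r s k / qpochs_inf [fps_X ^ s, fps_X ^ (r - s)] (fps_X ^ r))) n \<ge> 0)) \<and>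
        (odd s \<and>
           real k > (8 * real r ^ 3 * real s - 2 * real s * (real r - 2 * real s))
                      / (real r * (real r - 2 * real s)) \<longrightarrow>
         (\<forall>n. fps_nth (theta_sum r s k /
                 ((1 - fps_X ^ s) * (1 - fps_X ^ (r - s)) * (1 - fps_X ^ (2 * r - s)))) n \<ge> 0) \<and>
         (\<forall>n. fps_nth ((-1) ^ k *
                 (tail_sum r s k / qpochs_inf [fps_X ^ s, fps_X ^ (r - s)] (fps_X ^ r))) n \<ge> 0))"
proof (intro conjI impI; elim conjE)
  let ?Q = "\<lambda>a. qpoch_inf (fps_X ^ a) (fps_X ^ r)"
  have s: "1 \<le> s" "2 * s < r" "2 * s \<le> r" "0 < r - s" "0 < r"
    using assms by auto
  have "coprime (r - s + s) s"
    using assms(1) s by simp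
  then have rs_coprime: "coprime (r - s) s"
    by (metis coprime_iff_gcd_eq_1 gcd_add1)
  have add: "coprime a (b + a)" if "coprime a b" for a b :: nat
    using that by (metis coprime_iff_gcd_eq_1 gcd_add2 add.commute)
  have pos: "0 < s" "0 < s + r" "0 < r - s" "0 < 2 * r - s"
    using s by auto
  have P_eq: "qpochs_inf [fps_X ^ s, fps_X ^ (r - s)] (fps_X ^ r) = ?Q s * ?Q (r - s)"
    by (simp add: qpochs_inf_def)
  have Q_unfold: "?Q a = (1 - fps_X ^ a) * ?Q (a + r)" if "0 < a" for a
    using that s by (intro qpoch_inf_unfold)
  have Q0: "fps_nth (?Q a * ?Q b) 0 \<noteq> 0" if "0 < a" "0 < b" for a b
    using that s by (simp add: fps_nth_0_qpoch_inf)
  have Q_nonneg: "0 \<le> fps_nth (inverse (?Q a * ?Q b)) n" if "0 < a" "0 < b" for a b n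
    unfolding fps_inverse_mult using that s by (intro fps_mult_nonneg inverse_qpoch_inf_nonneg)
  {
    assume "even s"
      and k: "real k > (4 * real r ^ 3 * real s - 2 * real s * (real r - 2 * real s))
        / (real r * (real r - 2 * real s))"
    let ?D = "(1 - fps_X ^ s) * (1 - fps_X ^ (r - s)) * (1 - fps_X ^ (r + s)) :: real fps"
    \<comment> \<open>Evenness compensates for the smaller constant 4: still 4 s >= 8.\<close>
    have "2 \<le> s" using \<open>even s\<close> s(1) by (metis dvd_imp_le less_le_trans zero_less_one)
    then have "8 * real r \<le> real k"
      using s by (intro k_lower_bound[OF _ _ _ _ k]) auto
    then have k8: "8 * r \<le> k" by linarith
    \<comment> \<open>gcd(r - s, r + s) = gcd(r - s, 2 s), and r - s is odd.\<close>
    have "odd r"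
      using assms(1) \<open>even s\<close> by (metis coprime_common_divisor odd_one)
    then have "coprime (r - s) 2"
      using \<open>even s\<close> s by simp
    then have "coprime (r - s) (2 * s)"
      using rs_coprime by simp
    then have "coprime (r - s) (2 * s + (r - s))"
      by (rule add)
    moreover have "2 * s + (r - s) = r + s"
      using s by simp
    ultimately have coprime: "coprime (r - s) (r + s)"
      by (simp only:)
    have D0: "fps_nth ?D 0 \<noteq> 0" using s by simp
    show th: "\<forall>n. 0 \<le> fps_nth (theta_sum r s k / ?D) n"
      using s k8 coprime by (intro allI theta_quotient_nonneg) auto
    \<comment> \<open>The factor 1 - q^(r+s) is the second one of the product starting at q^s, which
      is therefore unfolded twice.\<close>
    have "qpochs_inf [fps_X ^ s, fps_X ^ (r - s)] (fps_X ^ r) = ?D * (?Q (s + r + r) * ?Q (r - s + r))"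
      unfolding P_eq Q_unfold[OF pos(1)] Q_unfold[OF pos(2)] Q_unfold[OF pos(3)]
      by (simp only: mult_ac add.commute[of s r])
    then show "\<forall>n. 0 \<le> fps_nth ((-1) ^ k *
        (tail_sum r s k / qpochs_inf [fps_X ^ s, fps_X ^ (r - s)] (fps_X ^ r))) n"
      using th tail_quotient_nonneg[OF s(1,3), of ?D] Q0 Q_nonneg D0 pos by simp
  next
    assume "odd s"
      and k: "real k > (8 * real r ^ 3 * real s - 2 * real s * (real r - 2 * real s))
        / (real r * (real r - 2 * real s))"
    let ?D = "(1 - fps_X ^ s) * (1 - fps_X ^ (r - s)) * (1 - fps_X ^ (2 * r - s)) :: real fps"
    have "8 * real r \<le> real k"
      using s by (intro k_lower_bound[OF _ _ _ _ k]) auto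
    then have k8: "8 * r \<le> k" by linarith
    have "coprime (r - s) (s + (r - s) + (r - s))"
      by (intro add rs_coprime)
    moreover have "s + (r - s) + (r - s) = 2 * r - s"
      using s by simp
    ultimately have coprime: "coprime (r - s) (2 * r - s)"
      by (simp only:)
    have D0: "fps_nth ?D 0 \<noteq> 0" using s by simp
    show th: "\<forall>n. 0 \<le> fps_nth (theta_sum r s k / ?D) n"
      using s k8 coprime by (intro allI theta_quotient_nonneg) auto
    \<comment> \<open>Here the third factor is the second one of the product starting at
      q^(r-s).\<close>
    have twice: "r - s + r = 2 * r - s" using s by simp
    have "qpochs_inf [fps_X ^ s, fps_X ^ (r - s)] (fps_X ^ r) = ?D * (?Q (s + r) * ?Q (2 * r - s + r))"
      unfolding P_eq Q_unfold[OF pos(1)] Q_unfold[OF pos(3)] twice Q_unfold[OF pos(4)]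
      by (simp only: mult_ac)
    then show "\<forall>n. 0 \<le> fps_nth ((-1) ^ k *
        (tail_sum r s k / qpochs_inf [fps_X ^ s, fps_X ^ (r - s)] (fps_X ^ r))) n"
      using th tail_quotient_nonneg[OF s(1,3), of ?D] Q0 Q_nonneg D0 pos by simp
  }
qed

end
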